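(* Let $t\ge 2$ be an integer, let $S=\{n_1,n_2,\ldots,n_t\}$ be a set of integers with $n_1>n_2>\cdots>n_t$ and $\min(S)\ge 3$, and let $s_1,s_2,\ldots,s_t$ be positive integers. Then the 3-uniform bi-hypergraph $\mathcal{H}_{n_1,\ldots,n_1,n_2,\ldots,n_2,\ldots,n_t,\ldots,n_t}$, where each $n_i$ appears exactly $s_i$ times in the index vector $(n_1,\ldots,n_1,n_2,\ldots,n_2,\ldots,n_t,\ldots,n_t)$, has feasible set $S$ and satisfies $r_{n_i}=s_i$ for every $i\in\{1,\ldots,t\}$.
   Context: For a positive integer $n$, $[n]=\{1,2,\ldots,n\}$. A bi-hypergraph $\mathcal{H}=(X,\mathcal{B})$ consists of a finite set $X$ of vertices and a family $\mathcal{B}$ of subsets of $X$, called bi-edges; it is 3-uniform if every bi-edge has exactly three elements. A proper $k$-coloring of $\mathcal{H}$ is a map from $X$ into a set of $k$ colors such that each bi-edge contains two vertices with a common color and also contains two vertices with distinct colors. A strict $k$-coloring is a proper $k$-coloring that uses all $k$ colors. The feasible set $\Phi(\mathcal{H})$ is the set of all $k$ such that $\mathcal{H}$ has a strict $k$-coloring. For each $k$, $r_k$ denotes the number of partitions of $X$ into $k$ nonempty color classes that arise from strict $k$-colorings of $\mathcal{H}$ (so colorings are counted up to renaming of colors). Construction: for integers $m\ge 2$ and $a_1\ge a_2\ge\cdots\ge a_m\ge 3$, let $X_{a_1,\ldots,a_m}=\{(x_1,\ldots,x_m) : x_j\in[a_j],\ j\in[m]\}$ and let $\mathcal{B}_{a_1,\ldots,a_m}$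 be the family of all sets $\{(x_1,\ldots,x_m),(y_1,\ldots,y_m),(z_1,\ldots,z_m)\}$ of three distinct elements of $X_{a_1,\ldots,a_m}$ such that $|\{x_j,y_j,z_j\}|=2$ for every $j\in[m]$. Then $\mathcal{H}_{a_1,\ldots,a_m}=(X_{a_1,\ldots,a_m},\mathcal{B}_{a_1,\ldots,a_m})$. *)

theory Defs
  imports Main
begin

record 'a bihypergraph =
  vertices :: "'a set"
  biedges :: "'a set set"

definition is_bihypergraph :: "'a bihypergraph \<Rightarrow> bool" where
  "is_bihypergraph H \<longleftrightarrow> finite (vertices H) \<and> (\<forall>e\<in>biedges H. e \<subseteq> vertices H)"

definition three_uniform :: "'a bihypergraph \<Rightarrow> bool" where
  "three_uniform H \<longleftrightarrow> (\<forall>e\<in>biedges H. card e = 3)"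

(* The set of k colors is taken to be [k]. A coloring is a total function of which only
   the values on the vertex set matter. *)
definition proper_coloring :: "'a bihypergraph \<Rightarrow> nat \<Rightarrow> ('a \<Rightarrow> nat) \<Rightarrow> bool" where
  "proper_coloring H k c \<longleftrightarrow>
     c ` vertices H \<subseteq> {1..k} \<and>
     (\<forall>e\<in>biedges H. (\<exists>u\<in>e. \<exists>v\<in>e. u \<noteq> v \<and> c u = c v) \<and>
                    (\<exists>u\<in>e. \<exists>v\<in>e. c u \<noteq> c v))"

definition strict_coloring :: "'a bihypergraph \<Rightarrow> nat \<Rightarrow> ('a \<Rightarrow> nat) \<Rightarrow> bool" where
  "strict_coloring H k c \<longleftrightarrow> proper_coloring H k c \<and> c ` vertices H = {1..k}"

definition feasible_set :: "'a bihypergraph \<Rightarrow> nat set" where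
  "feasible_set H = {k. \<exists>c. strict_coloring H k c}"

definition color_classes :: "'a bihypergraph \<Rightarrow> nat \<Rightarrow> ('a \<Rightarrow> nat) \<Rightarrow> 'a set set" where
  "color_classes H k c = (\<lambda>i. {x \<in> vertices H. c x = i}) ` {1..k}"

definition num_strict_partitions :: "'a bihypergraph \<Rightarrow> nat \<Rightarrow> nat" where
  "num_strict_partitions H k = card {color_classes H k c | c. strict_coloring H k c}"

(* The tuple (x_1, ..., x_m) is the list of length m whose entry at position j - 1 is x_j. *)
definition grid_vertices :: "nat list \<Rightarrow> nat list set" where
  "grid_vertices a = {x. length x = length a \<and> (\<forall>j<length a. x ! j \<in> {1..a ! j})}"

definition grid_biedges :: "nat list \<Rightarrow> nat list set set" where
  "grid_biedges a =
     {{x, y, z} | x y z. x \<in> grid_vertices a \<and> y \<in> grid_vertices a \<and> z \<in> grid_vertices a \<and>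
        x \<noteq> y \<and> y \<noteq> z \<and> x \<noteq> z \<and>
        (\<forall>j<length a. card {x ! j, y ! j, z ! j} = 2)}"

definition grid_bihypergraph :: "nat list \<Rightarrow> nat list bihypergraph" where
  "grid_bihypergraph a = \<lparr>vertices = grid_vertices a, biedges = grid_biedges a\<rparr>"

definition index_vector :: "nat \<Rightarrow> (nat \<Rightarrow> nat) \<Rightarrow> (nat \<Rightarrow> nat) \<Rightarrow> nat list" where
  "index_vector t n s = concat (map (\<lambda>i. replicate (s i) (n i)) [1..<Suc t])"

end

theory Submission
  imports Defs
begin

text \<open>
  Every proper coloring of a grid with at least two coordinates, each of at least three values,
  is a single coordinate followed by an injective renaming of its values. Conversely, each
  coordinate is a proper coloring, because a bi-edge takes exactly two values in it. Hence the
  strict \<open>k\<close>-colorings, up to renaming, correspond to the coordinates of size \<open>k\<close>. Different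
  coordinates induce different partitions, so \<open>r\<^sub>k\<close> is the number of coordinates of size \<open>k\<close>,
  and in the given index vector the size \<open>n\<^sub>i\<close> occurs exactly \<open>s\<^sub>i\<close> times.

  To see that a proper coloring follows one coordinate, fix \<open>j\<close> and regard the grid as a
  two-dimensional array whose row is the \<open>j\<close>-th coordinate and whose column is the tuple of the
  others. Whenever two columns differ in every remaining coordinate, three corners of
  a rectangle in this array form a bi-edge. So every such rectangle carries two colors, twice each,
  constant on its rows, on its columns, or on its diagonals. Since there are three rows and any two
  such columns extend to three, the diagonal pattern is impossible
  (\<open>array_no_diagonal\<close>). It follows that a change of color along coordinate \<open>j\<close>
  anywhere forces the color to ignore all the other coordinates
  (\<open>color_determined_by_coordinate\<close>). If there were no such change for any \<open>j\<close>, the coloring would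
  be constant, which the bi-edges forbid; this leaves exactly the
  coordinate colorings (\<open>proper_coloring_is_coordinate\<close>).
\<close>

section \<open>Arrays in which any three rectangle corners carry two colors\<close>

lemma card_three_eq_2_iff:
  "card {p, q, r} = 2 \<longleftrightarrow> (p = q \<and> q \<noteq> r) \<or> (p = r \<and> q \<noteq> r) \<or> (q = r \<and> p \<noteq> q)"
  by (auto simp: card_insert_if)

text \<open>
  Every rectangle carries two colors, twice each. As column \<open>p\<close> is not constant on rows
  \<open>u, v\<close>, the claim can only fail if \<open>f u p = f v q\<close> and \<open>f u q = f v p\<close> are two distinct colors
  \<open>A\<close>, \<open>B\<close>. Then the third row would consist of \<open>A\<close> and \<open>B\<close> on these columns, and
  so agree with one of the other two rows. In the third column these two equal rows would then
  have an entry different from \<open>A\<close> and from \<open>B\<close>, while rows \<open>u\<close> and \<open>v\<close> only admit \<open>A\<close> and \<open>B\<close> there.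
\<close>
lemma array_no_diagonal:
  fixes f :: "'r \<Rightarrow> 'l \<Rightarrow> 'c"
  assumes corner: "\<And>u v p q. u \<in> R \<Longrightarrow> v \<in> R \<Longrightarrow> u \<noteq> v \<Longrightarrow> p \<in> L \<Longrightarrow> q \<in> L \<Longrightarrow> p \<noteq> q \<Longrightarrow>
      card {f u p, f v p, f u q} = 2"
    and rows: "u \<in> R" "v \<in> R" "w \<in> R" "u \<noteq> v" "u \<noteq> w" "v \<noteq> w"
    and columns: "p \<in> L" "q \<in> L" "r \<in> L" "p \<noteq> q" "p \<noteq> r" "q \<noteq> r"
    and change: "f u p \<noteq> f v p"
  shows "f u p = f u q"
proof (rule ccontr)
  assume ne: "f u p \<noteq> f u q"
  have split: "(f a d = f a e \<and> f b d = f b e \<and> f a d \<noteq> f b d) \<or>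
      (f a d = f b d \<and> f a e = f b e \<and> f a d \<noteq> f a e) \<or>
      (f a d = f b e \<and> f a e = f b d \<and> f a d \<noteq> f a e)"
    if "a \<in> R" "b \<in> R" "a \<noteq> b" "d \<in> L" "e \<in> L" "d \<noteq> e" for a b d e
    using corner[of a b d e] corner[of b a d e] corner[of a b e d] corner[of b a e d] that
    unfolding card_three_eq_2_iff by metis
  have diag: "f u p = f v q" "f u q = f v p"
    using split[of u v p q] rows columns change ne by blast+
  have third_row: "(f w p = f u p \<and> f w q = f u q) \<or> (f w p = f v p \<and> f w q = f v q)"
    using split[of u w p q] rows columns diag ne by metis
  have third_column: "f u r \<in> {f u p, f u q}" "f v r \<in> {f u p, f u q}"
    using split[of u v p r] rows columns diag ne by auto
  show False
    using third_row
  proof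
    assume "f w p = f u p \<and> f w q = f u q"
    then have "f u r \<noteq> f u p" "f u r \<noteq> f u q"
      using split[of u w p r] split[of u w q r] rows columns by metis+
    then show False using third_column by blast
  next
    assume "f w p = f v p \<and> f w q = f v q"
    then have "f v r \<noteq> f v p" "f v r \<noteq> f v q"
      using split[of v w p r] split[of v w q r] rows columns by metis+
    then show False using third_column diag by auto
  qed
qed

section \<open>The grid as a bi-hypergraph\<close>

lemma grid_sel [simp]:
  "vertices (grid_bihypergraph a) = grid_vertices a"
  "biedges (grid_bihypergraph a) = grid_biedges a"
  by (simp_all add: grid_bihypergraph_def)

lemma length_grid_vertex: "x \<in> grid_vertices a \<Longrightarrow> length x = length a"
  by (simp add: grid_vertices_def)

lemma nth_grid_vertex: "x \<in> grid_vertices a \<Longrightarrow> j < length a \<Longrightarrow> x ! j \<in> {1..a ! j}"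
  by (simp add: grid_vertices_def)

lemma grid_vertex_update:
  "x \<in> grid_vertices a \<Longrightarrow> v \<in> {1..a ! j} \<Longrightarrow> x[j := v] \<in> grid_vertices a"
  by (cases "j < length a") (auto simp: grid_vertices_def nth_list_update)

lemma finite_grid_vertices: "finite (grid_vertices a)"
proof (rule finite_subset)
  show "grid_vertices a \<subseteq> {x. set x \<subseteq> (\<Union>j<length a. {1..a ! j}) \<and> length x = length a}"
    by (fastforce simp: grid_vertices_def in_set_conv_nth)
qed (simp add: finite_lists_length_eq)

lemma is_bihypergraph_grid: "is_bihypergraph (grid_bihypergraph a)"
  by (auto simp: is_bihypergraph_def finite_grid_vertices grid_biedges_def)

lemma three_uniform_grid: "three_uniform (grid_bihypergraph a)"
  by (auto simp: three_uniform_def grid_biedges_def)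

lemma proper_coloring_on_biedge:
  assumes "proper_coloring (grid_bihypergraph a) k c"
    and "x \<in> grid_vertices a" "y \<in> grid_vertices a" "z \<in> grid_vertices a"
    and "x \<noteq> y" "y \<noteq> z" "x \<noteq> z" "\<And>j. j < length a \<Longrightarrow> card {x ! j, y ! j, z ! j} = 2"
  shows "card {c x, c y, c z} = 2"
proof -
  have "{x, y, z} \<in> grid_biedges a"
    using assms unfolding grid_biedges_def by blast
  then have "(\<exists>u\<in>{x, y, z}. \<exists>v\<in>{x, y, z}. u \<noteq> v \<and> c u = c v) \<and>
      (\<exists>u\<in>{x, y, z}. \<exists>v\<in>{x, y, z}. c u \<noteq> c v)"
    using assms(1) unfolding proper_coloring_def grid_sel by blast
  then show ?thesis
    unfolding card_three_eq_2_iff by auto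
qed

section \<open>Proper colorings of large grids\<close>

lemma ex_third_value:
  fixes N u v :: nat
  assumes "N \<ge> 3"
  shows "\<exists>w\<in>{1..N}. w \<noteq> u \<and> w \<noteq> v"
proof -
  have "card ({1..N} - {u, v}) > 0"
    using assms diff_card_le_card_Diff[of "{u, v}" "{1..N}"] card_insert_le_m1[of 2 "{v}" u]
    by simp
  then show ?thesis
    by (metis Diff_iff card_gt_0_iff ex_in_conv insertCI)
qed

locale large_grid =
  fixes a :: "nat list"
  assumes length_ge: "length a \<ge> 2"
    and size_ge: "j < length a \<Longrightarrow> a ! j \<ge> 3"
begin

text \<open>
  Differing everywhere is the relation between columns that turns rectangle corners into bi-edges.
  A common such neighbor of any two tuples serves both as a third column and, for tuples that
  agree somewhere, as an intermediate column to pass through.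
\<close>
lemma ex_vertex_avoiding:
  "\<exists>z\<in>grid_vertices a. \<forall>j<length a. z ! j \<noteq> x ! j \<and> z ! j \<noteq> y ! j"
proof -
  have "\<forall>j. \<exists>w. j < length a \<longrightarrow> w \<in> {1..a ! j} \<and> w \<noteq> x ! j \<and> w \<noteq> y ! j"
    using ex_third_value[OF size_ge] by meson
  then obtain g where
    g: "\<And>j. j < length a \<Longrightarrow> g j \<in> {1..a ! j} \<and> g j \<noteq> x ! j \<and> g j \<noteq> y ! j"
    by metis
  then have "map g [0..<length a] \<in> grid_vertices a"
    by (auto simp: grid_vertices_def)
  then show ?thesis
    using g by (intro bexI[of _ "map g [0..<length a]"]) auto
qed

lemma ones_in_grid: "replicate (length a) 1 \<in> grid_vertices a"
  using size_ge by (fastforce simp: grid_vertices_def)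

end

locale large_grid_coloring = large_grid +
  fixes k :: nat and c :: "nat list \<Rightarrow> nat"
  assumes proper: "proper_coloring (grid_bihypergraph a) k c"
begin

lemma corner_two_colors:
  assumes "j < length a" "x \<in> grid_vertices a" "y \<in> grid_vertices a"
    and "v \<in> {1..a ! j}" "w \<in> {1..a ! j}" "v \<noteq> w"
    and off: "\<And>i. i < length a \<Longrightarrow> i \<noteq> j \<Longrightarrow> x ! i \<noteq> y ! i"
  shows "card {c (x[j := v]), c (x[j := w]), c (y[j := v])} = 2"
proof (rule proper_coloring_on_biedge[OF proper])
  have len: "length x = length a" "length y = length a"
    using assms length_grid_vertex by auto
  \<comment> \<open>A second coordinate separates the two columns even after coordinate \<open>j\<close> is overwritten.\<close>
  obtain i where i: "i < length a" "i \<noteq> j"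
  proof (cases "j = 0")
    case True
    then show ?thesis using that[of 1] length_ge by simp
  next
    case False
    then show ?thesis using that[of 0] assms(1) by linarith
  qed
  then have "x[j := u] ! i \<noteq> y[j := u'] ! i" for u u'
    using off by simp
  then show "x[j := w] \<noteq> y[j := v]" "x[j := v] \<noteq> y[j := v]"
    by metis+
  show "x[j := v] \<noteq> x[j := w]"
    using assms len by (metis nth_list_update_eq)
  show "card {x[j := v] ! i, x[j := w] ! i, y[j := v] ! i} = 2" if "i < length a" for i
    using that off[of i] assms len by (cases "i = j") (auto simp: card_three_eq_2_iff)
qed (use assms grid_vertex_update in auto)

lemma color_change_neighbor:
  assumes j: "j < length a" and x: "x \<in> grid_vertices a" and y: "y \<in> grid_vertices a"
    and vw: "v \<in> {1..a ! j}" "w \<in> {1..a ! j}"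
    and off: "\<And>i. i < length a \<Longrightarrow> x ! i \<noteq> y ! i"
    and change: "c (x[j := v]) \<noteq> c (x[j := w])"
  shows "c (x[j := v]) = c (y[j := v])"
proof -
  obtain z where z: "z \<in> grid_vertices a" "\<And>i. i < length a \<Longrightarrow> z ! i \<noteq> x ! i \<and> z ! i \<noteq> y ! i"
    using ex_vertex_avoiding[of x y] by blast
  obtain u where u: "u \<in> {1..a ! j}" "u \<noteq> v" "u \<noteq> w"
    using ex_third_value[OF size_ge[OF j], of v w] by blast
  have distinct: "x \<noteq> y" "x \<noteq> z" "y \<noteq> z"
    using off z j by metis+
  have "card {c (q[j := s]), c (q[j := s']), c (q'[j := s])} = 2"
    if "s \<in> {1..a ! j}" "s' \<in> {1..a ! j}" "s \<noteq> s'" "q \<in> {x, y, z}" "q' \<in> {x, y, z}" "q \<noteq> q'"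
    for s s' q q'
  proof (rule corner_two_colors[OF j])
    show "q ! i \<noteq> q' ! i" if "i < length a" for i
      using that off z \<open>q \<in> {x, y, z}\<close> \<open>q' \<in> {x, y, z}\<close> \<open>q \<noteq> q'\<close>
      by (metis empty_iff insert_iff)
  qed (use that x y z in auto)
  then show ?thesis
    by (rule array_no_diagonal[where f = "\<lambda>s q. c (q[j := s])" and R = "{1..a ! j}"
          and L = "{x, y, z}" and u = v and v = w and w = u and p = x and q = y and r = z])
      (use vw u distinct change in auto)
qed

text \<open>
  Any two columns have a common neighbor, and by \<open>color_change_neighbor\<close> a change of color
  between two rows is carried over to it unchanged, so it is visible in all columns.
\<close>
lemma color_change_everywhere:
  assumes "j < length a" "x \<in> grid_vertices a" "z \<in> grid_vertices a"
    and "v \<in> {1..a ! j}" "w \<in> {1..a ! j}" "c (x[j := v]) \<noteq> c (x[j := w])"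
  shows "c (x[j := v]) = c (z[j := v])"
proof -
  obtain y where y: "y \<in> grid_vertices a" "\<And>i. i < length a \<Longrightarrow> y ! i \<noteq> x ! i \<and> y ! i \<noteq> z ! i"
    using ex_vertex_avoiding[of x z] by blast
  have xy: "c (x[j := v]) = c (y[j := v])" "c (x[j := w]) = c (y[j := w])"
    using color_change_neighbor[of j x y] assms y by metis+
  then have "c (y[j := v]) = c (z[j := v])"
    using color_change_neighbor[of j y z v w] assms y by metis
  with xy show ?thesis by simp
qed

text \<open>
  A third value of coordinate \<open>j\<close> differs in color from one of the two values between which the
  color changes, so \<open>color_change_everywhere\<close> applies to every value.
\<close>
lemma color_determined_by_coordinate:
  assumes "j < length a" "x \<in> grid_vertices a" "z \<in> grid_vertices a"
    and "v \<in> {1..a ! j}" "w \<in> {1..a ! j}" "c (x[j := v]) \<noteq> c (x[j := w])"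
  shows "c z = c (x[j := z ! j])"
proof -
  have zj: "z ! j \<in> {1..a ! j}"
    using assms nth_grid_vertex by blast
  have "c (x[j := z ! j]) \<noteq> c (x[j := v]) \<or> c (x[j := z ! j]) \<noteq> c (x[j := w])"
    using assms(6) by auto
  then have "c (x[j := z ! j]) = c (z[j := z ! j])"
    using color_change_everywhere[OF assms(1-3) zj] assms(4,5) by blast
  then show ?thesis by simp
qed

text \<open>
  If two values of coordinate \<open>j\<close> had the same color, the three corners of any rectangle
  on these two rows would form a bi-edge of a single color.
\<close>
lemma coordinate_renaming_inj:
  assumes "j < length a" "\<And>z. z \<in> grid_vertices a \<Longrightarrow> c z = f (z ! j)"
  shows "inj_on f {1..a ! j}"
proof (rule inj_onI, rule ccontr)
  fix v w assume vw: "v \<in> {1..a ! j}" "w \<in> {1..a ! j}" "f v = f w" "v \<noteq> w"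
  obtain x where x: "x \<in> grid_vertices a"
    using ones_in_grid by blast
  obtain y where y: "y \<in> grid_vertices a" "\<And>i. i < length a \<Longrightarrow> y ! i \<noteq> x ! i"
    using ex_vertex_avoiding[of x x] by blast
  have "card {c (x[j := v]), c (x[j := w]), c (y[j := v])} = 2"
    by (rule corner_two_colors) (use assms(1) x y vw in \<open>auto dest: y(2)\<close>)
  moreover have "c (q[j := u]) = f u" if "q \<in> grid_vertices a" "u \<in> {1..a ! j}" for q u
    using that assms grid_vertex_update[of q a u j] length_grid_vertex[of q a] by simp
  ultimately show False
    using x y vw by simp
qed

text \<open>
  If no single coordinate could change the color, replacing the entries of \<open>x\<close> by those of \<open>y\<close>
  one after the other would show the coloring to be constant.
\<close>
lemma ex_color_change:
  "\<exists>j<length a. \<exists>x\<in>grid_vertices a. \<exists>v\<in>{1..a ! j}. c (x[j := v]) \<noteq> c x"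
proof (rule ccontr)
  assume "\<not> ?thesis"
  then have ignore: "c (x[j := v]) = c x"
    if "j < length a" "x \<in> grid_vertices a" "v \<in> {1..a ! j}" for j x v
    using that by blast
  have const: "c x = c y" if x: "x \<in> grid_vertices a" and y: "y \<in> grid_vertices a" for x y
  proof -
    have "i \<le> length a \<Longrightarrow> take i y @ drop i x \<in> grid_vertices a \<and> c (take i y @ drop i x) = c x"
      for i
    proof (induction i)
      case 0
      then show ?case using x by simp
    next
      case (Suc i)
      have "take (Suc i) y @ drop (Suc i) x = (take i y @ drop i x)[i := y ! i]"
        using Suc.prems length_grid_vertex[OF x] length_grid_vertex[OF y]
        by (simp add: list_update_append take_Suc_conv_app_nth min_def Cons_nth_drop_Suc[symmetric])
      then show ?case
        using Suc nth_grid_vertex[OF y, of i] ignore[of i "take i y @ drop i x" "y ! i"]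
          grid_vertex_update[of "take i y @ drop i x" a "y ! i" i]
        by simp
    qed
    from this[of "length a"] show ?thesis
      using length_grid_vertex[OF x] length_grid_vertex[OF y] by simp
  qed
  have "0 < length a"
    using length_ge by linarith
  then have "inj_on (\<lambda>_. c (replicate (length a) 1)) {1..a ! 0}"
    by (rule coordinate_renaming_inj) (rule const[OF _ ones_in_grid])
  then show False
    using size_ge[OF \<open>0 < length a\<close>] inj_onD[of _ "{1..a ! 0}" 1 2] by fastforce
qed

theorem proper_coloring_is_coordinate:
  obtains j f where "j < length a" "inj_on f {1..a ! j}"
    "\<And>z. z \<in> grid_vertices a \<Longrightarrow> c z = f (z ! j)"
proof -
  obtain j x v where j: "j < length a" and x: "x \<in> grid_vertices a" and v: "v \<in> {1..a ! j}"
    and change: "c (x[j := v]) \<noteq> c (x[j := x ! j])"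
    using ex_color_change by auto
  have "c z = c (x[j := z ! j])" if "z \<in> grid_vertices a" for z
    using color_determined_by_coordinate[OF j x that v nth_grid_vertex[OF x j] change] .
  then show ?thesis
    using that[of j "\<lambda>u. c (x[j := u])"] coordinate_renaming_inj[OF j, of "\<lambda>u. c (x[j := u])"] j by blast
qed

end

section \<open>Strict colorings and their partitions\<close>

context large_grid
begin

abbreviation coordinate_partition :: "nat \<Rightarrow> nat list set set" where
  "coordinate_partition j \<equiv> color_classes (grid_bihypergraph a) (a ! j) (\<lambda>x. x ! j)"

lemma coordinate_image:
  assumes "j < length a"
  shows "(\<lambda>x. x ! j) ` grid_vertices a = {1..a ! j}"
proof
  show "{1..a ! j} \<subseteq> (\<lambda>x. x ! j) ` grid_vertices a"
  proof
    fix v assume "v \<in> {1..a ! j}"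
    then show "v \<in> (\<lambda>x. x ! j) ` grid_vertices a"
      using assms grid_vertex_update[OF ones_in_grid]
      by (intro image_eqI[of _ _ "(replicate (length a) 1)[j := v]"]) auto
  qed
qed (use assms nth_grid_vertex in blast)

lemma strict_coloring_coordinate:
  assumes "j < length a"
  shows "strict_coloring (grid_bihypergraph a) (a ! j) (\<lambda>x. x ! j)"
proof -
  have "(\<exists>u\<in>e. \<exists>v\<in>e. u \<noteq> v \<and> u ! j = v ! j) \<and> (\<exists>u\<in>e. \<exists>v\<in>e. u ! j \<noteq> v ! j)"
    if "e \<in> grid_biedges a" for e
  proof -
    obtain x y z where e: "e = {x, y, z}" "x \<noteq> y" "y \<noteq> z" "x \<noteq> z"
      and "\<forall>j<length a. card {x ! j, y ! j, z ! j} = 2"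
      using \<open>e \<in> grid_biedges a\<close> unfolding grid_biedges_def by blast
    then have "card {x ! j, y ! j, z ! j} = 2"
      using assms by blast
    then show ?thesis
      using e(2-) unfolding e(1) card_three_eq_2_iff by auto
  qed
  then show ?thesis
    using coordinate_image[OF assms]
    unfolding strict_coloring_def proper_coloring_def grid_sel by simp
qed

lemma strict_coloring_partition:
  assumes "strict_coloring (grid_bihypergraph a) k c"
  shows "\<exists>j<length a. k = a ! j \<and> color_classes (grid_bihypergraph a) k c = coordinate_partition j"
proof -
  interpret large_grid_coloring a k c
    using assms by unfold_locales (simp add: strict_coloring_def)
  obtain j f where j: "j < length a" and inj: "inj_on f {1..a ! j}"
    and c: "\<And>z. z \<in> grid_vertices a \<Longrightarrow> c z = f (z ! j)"
    using proper_coloring_is_coordinate by metis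
  have "c ` grid_vertices a = f ` (\<lambda>x. x ! j) ` grid_vertices a"
    using c by (auto simp: image_image)
  then have img: "{1..k} = f ` {1..a ! j}"
    using assms coordinate_image[OF j] by (simp add: strict_coloring_def)
  then have k: "k = a ! j"
    using card_image[OF inj] by (metis card_atLeastAtMost diff_Suc_1)
  have "{x \<in> grid_vertices a. c x = f v} = {x \<in> grid_vertices a. x ! j = v}"
    if "v \<in> {1..a ! j}" for v
    using that c inj nth_grid_vertex[OF _ j] by (auto simp: inj_on_eq_iff)
  then have "color_classes (grid_bihypergraph a) k c = coordinate_partition j"
    unfolding color_classes_def img grid_sel image_image by (intro image_cong) auto
  with j k show ?thesis by blast
qed

lemma feasible_set_grid: "feasible_set (grid_bihypergraph a) = set a"
  using strict_coloring_partition strict_coloring_coordinate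
  unfolding feasible_set_def in_set_conv_nth set_eq_iff by fastforce

text \<open>
  The block \<open>{x. x\<^sub>i = 1}\<close> of the first partition contains the vertex \<open>(1, \<dots>, 1)\<close> and the vertex
  obtained from it by setting coordinate \<open>j\<close> to 2, which the second partition separates.
\<close>
lemma coordinate_partition_inj: "inj_on coordinate_partition {..<length a}"
proof (rule inj_onI, rule ccontr)
  fix i j assume ij: "i \<in> {..<length a}" "j \<in> {..<length a}" "i \<noteq> j"
    and eq: "coordinate_partition i = coordinate_partition j"
  let ?x = "replicate (length a) (1::nat)"
  have two: "1 \<in> {1..a ! i}" "2 \<in> {1..a ! j}"
    using size_ge[of i] size_ge[of j] ij by auto
  have "{x \<in> grid_vertices a. x ! i = 1} \<in> coordinate_partition i"
    using two by (auto simp: color_classes_def)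
  then obtain v where v: "{x \<in> grid_vertices a. x ! i = 1} = {x \<in> grid_vertices a. x ! j = v}"
    unfolding eq by (auto simp: color_classes_def)
  have "?x \<in> {x \<in> grid_vertices a. x ! i = 1}"
    using ones_in_grid ij by simp
  then have "?x ! j = v"
    unfolding v by simp
  moreover have "?x[j := 2] \<in> {x \<in> grid_vertices a. x ! i = 1}"
    using grid_vertex_update[OF ones_in_grid two(2)] ij by simp
  then have "?x[j := 2] ! j = v"
    unfolding v by simp
  ultimately show False
    using ij by simp
qed

lemma num_strict_partitions_grid:
  "num_strict_partitions (grid_bihypergraph a) k = count_list a k"
proof -
  have "{color_classes (grid_bihypergraph a) k c | c. strict_coloring (grid_bihypergraph a) k c} =
      coordinate_partition ` {j. j < length a \<and> k = a ! j}"
    using strict_coloring_partition strict_coloring_coordinate by blast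
  moreover have "inj_on coordinate_partition {j. j < length a \<and> k = a ! j}"
    using coordinate_partition_inj by (rule inj_on_subset) auto
  ultimately show ?thesis
    by (simp add: num_strict_partitions_def card_image count_list_eq_length_filter
        length_filter_conv_card)
qed

end

section \<open>The index vector\<close>

lemma count_list_replicate: "count_list (replicate m y) x = (if x = y then m else 0)"
  by (induction m) auto

lemma count_list_concat_blocks:
  assumes "distinct is" "inj_on n (set is)" "i \<in> set is"
  shows "count_list (concat (map (\<lambda>i. replicate (s i) (n i)) is)) (n i) = s i"
proof -
  have "count_list (concat (map (\<lambda>i. replicate (s i) (n i)) js)) y =
      (\<Sum>l\<leftarrow>js. if y = n l then s l else 0)" for js y
    by (induction js) (auto simp: count_list_replicate)
  then have "count_list (concat (map (\<lambda>i. replicate (s i) (n i)) is)) (n i) =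
      (\<Sum>l\<in>set is. if n i = n l then s l else 0)"
    using assms(1) by (simp add: sum_list_distinct_conv_sum_set)
  also have "\<dots> = (\<Sum>l\<in>set is. if i = l then s l else 0)"
    using assms(2,3) by (intro sum.cong) (auto simp: inj_on_eq_iff)
  finally show ?thesis
    using assms(3) by simp
qed

theorem theorem2p3:
  fixes t :: nat and n s :: "nat \<Rightarrow> nat" and S :: "nat set"
  assumes "t \<ge> 2"
    and "S = n ` {1..t}"
    and "\<And>i j. i \<in> {1..t} \<Longrightarrow> j \<in> {1..t} \<Longrightarrow> i < j \<Longrightarrow> n i > n j"
    and "Min S \<ge> 3"
    and "\<And>i. i \<in> {1..t} \<Longrightarrow> s i > 0"
  defines "H \<equiv> grid_bihypergraph (index_vector t n s)"
  shows "is_bihypergraph H \<and> three_uniform H \<and> feasible_set H = S \<and>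
    (\<forall>i\<in>{1..t}. num_strict_partitions H (n i) = s i)"
proof -
  let ?a = "index_vector t n s"
  have range: "set [1..<Suc t] = {1..t}"
    by auto
  have "set ?a = (\<Union>i\<in>{1..t}. set (replicate (s i) (n i)))"
    unfolding index_vector_def set_concat set_map range by simp
  also have "\<dots> = (\<Union>i\<in>{1..t}. {n i})"
    using assms(5) by (intro SUP_cong refl) (simp add: set_replicate_conv_if)
  finally have set_a: "set ?a = S"
    using assms(2) by (simp add: UNION_singleton_eq_range)
  have inj: "inj_on n {1..t}"
    using assms(3) by (metis inj_onI less_irrefl linorder_neqE_nat)
  have "card S = t"
    using card_image[OF inj] assms(2) by simp
  interpret large_grid ?a
  proof
    show "length ?a \<ge> 2"
      using card_length[of ?a] set_a \<open>card S = t\<close> \<open>t \<ge> 2\<close> by simp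
    show "?a ! j \<ge> 3" if "j < length ?a" for j
      using nth_mem[OF that] Min_le[of S "?a ! j"] assms(4)
      unfolding set_a[symmetric] by (meson List.finite_set le_trans)
  qed
  have "count_list ?a (n i) = s i" if "i \<in> {1..t}" for i
    unfolding index_vector_def
    by (rule count_list_concat_blocks) (use that inj range in \<open>simp_all del: upt_Suc\<close>)
  then show ?thesis
    unfolding H_def
    using is_bihypergraph_grid three_uniform_grid feasible_set_grid num_strict_partitions_grid set_a
    by simp
qed

end
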